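(* Let $\ell$ and $n$ be integers with $\ell\geq 1$ and $n> e^{\ell+2}$. Then $\pi_l(G_{n,\ell})>\ell$.
   Context: $G_{n,\ell}$ is the graph with vertex set $\{v_{2i-1}: i\in[n]\}\cup\{v_{2i}^j : i\in[n],\ j\in[\binom{\ell n}{\ell}]\}$, where two vertices are adjacent if and only if their lower indices differ by exactly $1$ (i.e. it is obtained from a path on $2n$ vertices by replacing every second vertex by an independent set of $\binom{\ell n}{\ell}$ vertices). Here $[m]=\{1,\dots,m\}$. A vertex coloring $\phi$ of a graph $G$ is nonrepetitive if there is no path (with no repeated vertices) $u_1\ldots u_{2r}$, $r\geq1$, with $\phi(u_i)=\phi(u_{r+i})$ for all $i\in[r]$. The Thue choice number $\pi_l(G)$ is the minimum $\ell$ such that for every assignment of lists $L_v$ with $|L_v|\geq\ell$ for all $v\in V(G)$ there is a nonrepetitive coloring $\phi$ of $G$ with $\phi(v)\in L_v$ for all $v$. *)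

theory Defs
  imports Complex_Main "Graph_Theory.Graph_Theory"
begin

text \<open>A vertex colouring only matters on the vertices of the graph. A path is a vertex sequence
  without repetitions (\<^const>\<open>vpath\<close>), and positions are counted from 0.\<close>

definition nonrepetitive :: "('v, 'e) pre_digraph \<Rightarrow> ('v \<Rightarrow> 'c) \<Rightarrow> bool" where
  "nonrepetitive G \<phi> \<longleftrightarrow>
     \<not> (\<exists>u r. r \<ge> 1 \<and> vpath u G \<and> length u = 2 * r \<and>
          (\<forall>i<r. \<phi> (u ! i) = \<phi> (u ! (r + i))))"

text \<open>Lists are finite sets of colours. Only finitely many colours occur in the lists of a finite
  graph, so natural numbers suffice as colours.\<close>

definition nonrepetitively_choosable :: "('v, 'e) pre_digraph \<Rightarrow> nat \<Rightarrow> bool" where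
  "nonrepetitively_choosable G k \<longleftrightarrow>
     (\<forall>L :: 'v \<Rightarrow> nat set. (\<forall>v \<in> verts G. finite (L v) \<and> card (L v) \<ge> k) \<longrightarrow>
        (\<exists>\<phi>. nonrepetitive G \<phi> \<and> (\<forall>v \<in> verts G. \<phi> v \<in> L v)))"

definition thue_choice_number :: "('v, 'e) pre_digraph \<Rightarrow> nat" where
  "thue_choice_number G = (LEAST k. nonrepetitively_choosable G k)"

text \<open>\<open>Single k\<close> stands for $v_k$ ($k$ odd) and \<open>Multi k j\<close> for $v_k^j$ ($k$ even).\<close>

datatype vertex = Single (lower_index: nat) | Multi (lower_index: nat) nat

definition G_verts :: "nat \<Rightarrow> nat \<Rightarrow> vertex set" where
  "G_verts n l = {Single (2 * i - 1) | i. i \<in> {1..n}} \<union>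
     {Multi (2 * i) j | i j. i \<in> {1..n} \<and> j \<in> {1..(l * n) choose l}}"

definition G_graph :: "nat \<Rightarrow> nat \<Rightarrow> vertex pair_pre_digraph" where
  "G_graph n l = \<lparr> pverts = G_verts n l,
     parcs = {(u, v). u \<in> G_verts n l \<and> v \<in> G_verts n l \<and>
                \<bar>int (lower_index u) - int (lower_index v)\<bar> = 1} \<rparr>"

lemma finite_G_verts: "finite (G_verts n l)"
proof -
  have "G_verts n l = (\<lambda>i. Single (2 * i - 1)) ` {1..n} \<union>
      (\<lambda>(i, j). Multi (2 * i) j) ` ({1..n} \<times> {1..(l * n) choose l})"
    unfolding G_verts_def by auto
  then show ?thesis by simp
qed

text \<open>Undirected simple graphs are represented by symmetric loop-free pair digraphs.\<close>

lemma pair_graph_G_graph: "pair_graph (G_graph n l)"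
proof
  show "finite (pverts (G_graph n l))" by (simp add: G_graph_def finite_G_verts)
  have "parcs (G_graph n l) \<subseteq> G_verts n l \<times> G_verts n l" by (auto simp: G_graph_def)
  then show "finite (parcs (G_graph n l))"
    by (rule finite_subset) (simp add: finite_G_verts)
  have "sym (parcs (G_graph n l))"
    by (rule symI) (simp add: G_graph_def abs_minus_commute)
  then show "symmetric (with_proj (G_graph n l))"
    by (simp add: symmetric_def)
next
  fix e assume "e \<in> parcs (G_graph n l)"
  then show "fst e \<in> pverts (G_graph n l)" "snd e \<in> pverts (G_graph n l)" "fst e \<noteq> snd e"
    by (auto simp: G_graph_def)
qed

text \<open>On a finite graph the minimum in \<^const>\<open>thue_choice_number\<close> is attained: lists with as many
  colours as there are vertices admit an injective choice.\<close>

lemma injective_choice: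
  assumes "finite A" "\<And>v. v \<in> A \<Longrightarrow> finite (L v) \<and> card (L v) \<ge> card A"
  shows "\<exists>\<phi>. inj_on \<phi> A \<and> (\<forall>v\<in>A. \<phi> v \<in> L v)"
  using assms
proof (induction A rule: finite_induct)
  case empty
  then show ?case by simp
next
  case (insert x A)
  have "finite (L v) \<and> card (L v) \<ge> card A" if "v \<in> A" for v
    using insert.prems[of v] that insert.hyps by auto
  then obtain \<phi> where \<phi>: "inj_on \<phi> A" "\<forall>v\<in>A. \<phi> v \<in> L v" using insert.IH by blast
  have "card (\<phi> ` A) < card (L x)"
    using insert.prems[of x] insert.hyps card_image_le[of A \<phi>] by auto
  then have "\<not> L x \<subseteq> \<phi> ` A"
    using card_mono[of "\<phi> ` A" "L x"] insert.hyps by auto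
  then obtain c where c: "c \<in> L x" "c \<notin> \<phi> ` A" by auto
  have "inj_on (\<phi>(x := c)) (insert x A)" "\<forall>v\<in>insert x A. (\<phi>(x := c)) v \<in> L v"
    using \<phi> c insert.hyps by (auto simp: inj_on_def)
  then show ?case by blast
qed

lemma nonrepetitive_if_inj_on:
  assumes "inj_on \<phi> (verts G)"
  shows "nonrepetitive G \<phi>"
  unfolding nonrepetitive_def
proof (intro notI, elim exE conjE)
  fix u and r :: nat
  assume r: "r \<ge> 1" and u: "vpath u G" "length u = 2 * r"
    and eq: "\<forall>i<r. \<phi> (u ! i) = \<phi> (u ! (r + i))"
  have sub: "set u \<subseteq> verts G" and dist: "distinct u"
    using u(1) by (auto simp: vpath_def vwalk_def)
  have "u ! 0 \<in> verts G" "u ! r \<in> verts G" using sub r u(2) by auto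
  moreover have "\<phi> (u ! 0) = \<phi> (u ! r)" using eq[rule_format, of 0] r by simp
  ultimately have "u ! 0 = u ! r" using assms by (auto dest: inj_onD)
  then show False using dist r u(2) nth_eq_iff_index_eq[of u 0 r] by auto
qed

lemma nonrepetitively_choosable_card_verts:
  assumes "finite (verts G)"
  shows "nonrepetitively_choosable G (card (verts G))"
  unfolding nonrepetitively_choosable_def
proof (intro allI impI)
  fix L :: "'a \<Rightarrow> nat set"
  assume "\<forall>v\<in>verts G. finite (L v) \<and> card (verts G) \<le> card (L v)"
  then have "\<exists>\<phi>. inj_on \<phi> (verts G) \<and> (\<forall>v\<in>verts G. \<phi> v \<in> L v)"
    by (intro injective_choice assms) simp
  then obtain \<phi> where "inj_on \<phi> (verts G)" and \<phi>: "\<forall>v\<in>verts G. \<phi> v \<in> L v"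
    by (elim exE conjE)
  from this(1) have "nonrepetitive G \<phi>" by (rule nonrepetitive_if_inj_on)
  with \<phi> show "\<exists>\<phi>. nonrepetitive G \<phi> \<and> (\<forall>v\<in>verts G. \<phi> v \<in> L v)" by (intro exI conjI)
qed

end

theory Submission
  imports Defs
begin

text \<open>Give the \<open>n\<close> vertices of odd index pairwise disjoint lists covering \<open>{..<l * n}\<close>, and let the
  copies at each even index carry all \<open>l\<close>-subsets of \<open>{..<l * n}\<close> as lists. Then fewer than \<open>l\<close>
  colours are missing at each even index, so at most \<open>(l - 1) n\<close> pairs \<open>(q, p)\<close> with \<open>q\<close> even and
  \<open>p\<close> odd are blocked, in the sense that the colour of the vertex of index \<open>p\<close> is missing at \<open>q\<close>.
  For odd \<open>r\<close>, a window of \<open>2r\<close> consecutive indices containing no blocked pair at distance \<open>r\<close>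
  carries a repetition, while a blocked pair at distance \<open>r\<close> lies in at most \<open>r\<close> of the
  \<open>2n - 2r + 1\<close> windows. Hence a nonrepetitive colouring has at least \<open>(2n + 1)/r - 2\<close> blocked pairs
  at distance \<open>r\<close>, and the sum over odd \<open>r \<le> n\<close> is about \<open>n ln n - n > (l - 1) n\<close>.\<close>

lemma vwalk_arcs_map_upt:
  "set (vwalk_arcs (map f [a..<b])) \<subseteq> {(f x, f (Suc x)) | x. a \<le> x \<and> Suc x < b}"
proof (induction "b - a" arbitrary: a)
  case 0
  then show ?case by simp
next
  case (Suc d)
  show ?case
  proof (cases "Suc a < b")
    case True
    then have "map f [a..<b] = f a # f (Suc a) # map f [Suc (Suc a)..<b]"
      and *: "map f [Suc a..<b] = f (Suc a) # map f [Suc (Suc a)..<b]"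
      by (simp_all add: upt_conv_Cons)
    then have "set (vwalk_arcs (map f [a..<b])) =
        insert (f a, f (Suc a)) (set (vwalk_arcs (map f [Suc a..<b])))"
      by simp
    then show ?thesis using Suc(1)[of "Suc a"] Suc(2) True by fastforce
  next
    case False
    then have "b = Suc a" using Suc(2) by simp
    then show ?thesis by simp
  qed
qed

lemma vpath_map_upt:
  assumes "a < b" "inj_on f {a..<b}"
    and "\<And>x. a \<le> x \<Longrightarrow> x < b \<Longrightarrow> f x \<in> verts G"
    and "\<And>x. a \<le> x \<Longrightarrow> Suc x < b \<Longrightarrow> (f x, f (Suc x)) \<in> arcs_ends G"
  shows "vpath (map f [a..<b]) G"
  using assms vwalk_arcs_map_upt[of f a b]
  by (auto simp: vpath_def vwalk_def distinct_map)

lemma Single_mem_G_verts: "odd p \<Longrightarrow> p \<le> 2 * n \<Longrightarrow> Single p \<in> G_verts n l"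
  unfolding G_verts_def by (intro UnI1 CollectI exI[of _ "Suc (p div 2)"]) (auto, presburger)

lemma Multi_mem_G_verts:
  "even q \<Longrightarrow> 1 \<le> q \<Longrightarrow> q \<le> 2 * n \<Longrightarrow> j \<in> {1..(l * n) choose l} \<Longrightarrow> Multi q j \<in> G_verts n l"
  unfolding G_verts_def by (intro UnI2 CollectI exI[of _ "q div 2"] exI[of _ j]) auto

text \<open>One vertex per index: \<open>lower_index\<close> inverts \<open>f\<close>, which gives
  distinctness, and successive lower indices differ by 1, which gives adjacency.\<close>

lemma vpath_G_graph:
  assumes "1 \<le> a" "a < b" "b \<le> Suc (2 * n)"
    and "\<And>x. a \<le> x \<Longrightarrow> x < b \<Longrightarrow> f x \<in> G_verts n l \<and> lower_index (f x) = x"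
  shows "vpath (map f [a..<b]) (with_proj (G_graph n l))"
proof (rule vpath_map_upt)
  show "inj_on f {a..<b}" by (rule inj_on_inverseI[where g = lower_index]) (use assms in auto)
qed (use assms in \<open>auto simp: G_graph_def arcs_ends_def arc_to_ends_def\<close>)

definition missing :: "nat \<Rightarrow> nat \<Rightarrow> (vertex \<Rightarrow> nat) \<Rightarrow> nat \<Rightarrow> nat set" where
  "missing n l \<phi> q = {..<l * n} - (\<lambda>j. \<phi> (Multi q j)) ` {1..(l * n) choose l}"

definition blocked :: "nat \<Rightarrow> nat \<Rightarrow> (vertex \<Rightarrow> nat) \<Rightarrow> (nat \<times> nat) set" where
  "blocked n l \<phi> = {(q, p). even q \<and> odd p \<and> q \<in> {1..2 * n} \<and> p \<in> {1..2 * n} \<and>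
     \<phi> (Single p) \<in> missing n l \<phi> q}"

text \<open>The form with \<open>max\<close> and \<open>min\<close> expresses |q - p| = r without
  truncated subtraction.\<close>

definition blocked_at :: "nat \<Rightarrow> nat \<Rightarrow> (vertex \<Rightarrow> nat) \<Rightarrow> nat \<Rightarrow> (nat \<times> nat) set" where
  "blocked_at n l \<phi> r = {(q, p) \<in> blocked n l \<phi>. max q p = min q p + r}"

lemma finite_blocked: "finite (blocked n l \<phi>)"
  by (rule finite_subset[of _ "{1..2 * n} \<times> {1..2 * n}"]) (auto simp: blocked_def)

text \<open>As \<open>r\<close> is odd, positions at distance \<open>r\<close> have opposite parity,
  so each compared pair contains one odd index and one even index. If the pair is not blocked, some
  copy at the even index has the colour of the odd vertex, and the path can go through that
  copy.\<close>

lemma exists_blocked_pair: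
  assumes nr: "nonrepetitive (with_proj (G_graph n l)) \<phi>"
    and col: "\<And>p. odd p \<Longrightarrow> p \<le> 2 * n \<Longrightarrow> \<phi> (Single p) < l * n"
    and r: "odd r" and a: "1 \<le> a" "a + 2 * r \<le> Suc (2 * n)"
  shows "\<exists>(q, p) \<in> blocked_at n l \<phi> r. a \<le> min q p \<and> min q p < a + r"
proof (rule ccontr)
  assume neg: "\<not> ?thesis"
  \<comment> \<open>\<open>s\<close> exchanges the two halves of the window, sending each position
    to the one it is compared with.\<close>
  define s where "s x = (if x < a + r then x + r else x - r)" for x
  have "\<exists>j \<in> {1..(l * n) choose l}. \<phi> (Multi x j) = \<phi> (Single (s x))"
    if x: "a \<le> x" "x < a + 2 * r" "even x" for x
  proof -
    have s: "odd (s x)" "1 \<le> s x" "s x \<le> 2 * n" "max x (s x) = min x (s x) + r"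
      "a \<le> min x (s x)" "min x (s x) < a + r"
      using x r a unfolding s_def by (auto split: if_splits)
    have "(x, s x) \<notin> blocked_at n l \<phi> r" using neg s(5,6) by blast
    then have "\<phi> (Single (s x)) \<notin> missing n l \<phi> x"
      using s x a by (auto simp: blocked_at_def blocked_def)
    then show ?thesis using col[of "s x"] s by (fastforce simp: missing_def)
  qed
  then obtain j where j: "\<And>x. a \<le> x \<Longrightarrow> x < a + 2 * r \<Longrightarrow> even x \<Longrightarrow>
      j x \<in> {1..(l * n) choose l} \<and> \<phi> (Multi x (j x)) = \<phi> (Single (s x))"
    by metis
  define f where "f x = (if even x then Multi x (j x) else Single x)" for x
  let ?u = "map f [a..<a + 2 * r]"
  have r1: "r \<ge> 1" using r by (cases r) auto
  have "vpath ?u (with_proj (G_graph n l))"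
  proof (rule vpath_G_graph)
    fix x assume "a \<le> x" "x < a + 2 * r"
    then show "f x \<in> G_verts n l \<and> lower_index (f x) = x"
      using j[of x] a by (auto simp: f_def intro!: Single_mem_G_verts Multi_mem_G_verts)
  qed (use a r1 in auto)
  moreover have "\<phi> (?u ! i) = \<phi> (?u ! (r + i))" if "i < r" for i
    using that r j[of "a + i"] j[of "a + r + i"]
    by (cases "even (a + i)") (auto simp: f_def s_def algebra_simps)
  ultimately have "\<not> nonrepetitive (with_proj (G_graph n l)) \<phi>"
    unfolding nonrepetitive_def using r1 by (auto intro!: exI[of _ ?u] exI[of _ r])
  then show False using nr by simp
qed

lemma card_blocked_at_ge:
  assumes "nonrepetitive (with_proj (G_graph n l)) \<phi>"
    and "\<And>p. odd p \<Longrightarrow> p \<le> 2 * n \<Longrightarrow> \<phi> (Single p) < l * n"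
    and "odd r"
  shows "2 * n + 1 \<le> r * (card (blocked_at n l \<phi> r) + 2)"
proof -
  let ?B = "blocked_at n l \<phi> r"
  \<comment> \<open>The starts \<open>a\<close> of windows that contain the pair: a \<le> min q p <
    a + r. Truncation at 0 can only shorten this interval, so it has at most \<open>r\<close>
    elements.\<close>
  let ?I = "\<lambda>(q, p). {min q p + 1 - r..min q p}"
  have fin: "finite ?B" by (rule finite_subset[OF _ finite_blocked]) (auto simp: blocked_at_def)
  have "{1..2 * n + 1 - 2 * r} \<subseteq> (\<Union>x\<in>?B. ?I x)"
  proof
    fix a assume "a \<in> {1..2 * n + 1 - 2 * r}"
    then have "1 \<le> a" "a + 2 * r \<le> Suc (2 * n)" by auto
    from exists_blocked_pair[OF assms this] show "a \<in> (\<Union>x\<in>?B. ?I x)" by fastforce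
  qed
  then have "card {1..2 * n + 1 - 2 * r} \<le> card (\<Union>x\<in>?B. ?I x)"
    by (intro card_mono) (use fin in auto)
  also have "\<dots> \<le> (\<Sum>x\<in>?B. card (?I x))" by (rule card_UN_le[OF fin])
  also have "\<dots> \<le> card ?B * r" by (rule sum_bounded_above[where K = r, simplified]) auto
  \<comment> \<open>If 2r > 2n there is no window and the truncated count is 0, but then 2n + 1
    \<le> 2r already gives the claim.\<close>
  finally show ?thesis by (simp add: algebra_simps)
qed

text \<open>By injectivity each colour missing at \<open>q\<close> blocks at most one odd
  index.\<close>

lemma card_blocked_le:
  assumes "inj_on (\<lambda>p. \<phi> (Single p)) {p \<in> {1..2 * n}. odd p}"
    and "\<And>q. even q \<Longrightarrow> q \<in> {1..2 * n} \<Longrightarrow> card (missing n l \<phi> q) < l"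
  shows "card (blocked n l \<phi>) \<le> n * (l - 1)"
proof -
  let ?E = "{q \<in> {1..2 * n}. even q}"
  let ?P = "\<lambda>q. {p \<in> {1..2 * n}. odd p \<and> \<phi> (Single p) \<in> missing n l \<phi> q}"
  have "?E = (\<lambda>i. 2 * i) ` {1..n}" by (auto simp: image_iff intro!: bexI[of _ "_ div 2"])
  then have E: "card ?E = n" by (simp add: card_image inj_on_def)
  have "blocked n l \<phi> = Sigma ?E ?P" by (auto simp: blocked_def)
  then have "card (blocked n l \<phi>) = (\<Sum>q\<in>?E. card (?P q))" by simp
  also have "\<dots> \<le> (\<Sum>q\<in>?E. l - 1)"
  proof (rule sum_mono)
    fix q assume q: "q \<in> ?E"
    have "card (?P q) \<le> card (missing n l \<phi> q)"
      by (rule card_inj_on_le[where f = "\<lambda>p. \<phi> (Single p)"])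
        (auto simp: missing_def intro: inj_on_subset[OF assms(1)])
    then show "card (?P q) \<le> l - 1" using assms(2)[of q] q by simp
  qed
  also have "\<dots> = n * (l - 1)" using E by simp
  finally show ?thesis .
qed

text \<open>Telescoping: each step uses ln (1 + x) \<le> x with x = 2 / (2m + 1).\<close>

lemma sum_inverse_odd_ge_ln: "ln (2 * real m + 1) / 2 \<le> (\<Sum>k<m. 1 / (2 * real k + 1))"
proof (induction m)
  case 0
  then show ?case by simp
next
  case (Suc m)
  have "ln (2 * real m + 3) - ln (2 * real m + 1) = ln ((2 * real m + 3) / (2 * real m + 1))"
    by (simp add: ln_div add_pos_nonneg add_nonneg_pos)
  also have "(2 * real m + 3) / (2 * real m + 1) = 1 + 2 / (2 * real m + 1)"
    by (simp add: field_simps)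
  also have "ln \<dots> \<le> 2 / (2 * real m + 1)" by (rule ln_add_one_self_le_self) simp
  finally show ?case using Suc by (simp add: add.commute)
qed

text \<open>A pair determines its distance, so the sets for different distances are
  disjoint.\<close>

lemma sum_card_blocked_at_le:
  "(\<Sum>k<m. card (blocked_at n l \<phi> (2 * k + 1))) \<le> card (blocked n l \<phi>)"
proof -
  have fin: "finite (blocked_at n l \<phi> r)" for r
    by (rule finite_subset[OF _ finite_blocked]) (auto simp: blocked_at_def)
  have "(\<Sum>k<m. card (blocked_at n l \<phi> (2 * k + 1))) =
      card (\<Union>k<m. blocked_at n l \<phi> (2 * k + 1))"
    by (subst card_UN_disjoint) (auto simp: fin, auto simp: blocked_at_def)
  also have "\<dots> \<le> card (blocked n l \<phi>)"
    by (rule card_mono[OF finite_blocked]) (auto simp: blocked_at_def)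
  finally show ?thesis .
qed

lemma not_nonrepetitive:
  assumes n: "real n > exp (real l + 2)"
    and col: "\<And>p. odd p \<Longrightarrow> p \<le> 2 * n \<Longrightarrow> \<phi> (Single p) < l * n"
    and inj: "inj_on (\<lambda>p. \<phi> (Single p)) {p \<in> {1..2 * n}. odd p}"
    and missing: "\<And>q. even q \<Longrightarrow> q \<in> {1..2 * n} \<Longrightarrow> card (missing n l \<phi> q) < l"
  shows "\<not> nonrepetitive (with_proj (G_graph n l)) \<phi>"
proof
  assume nr: "nonrepetitive (with_proj (G_graph n l)) \<phi>"
  \<comment> \<open>For k < m, 2k + 1 runs through the odd numbers up to \<open>n\<close>. Then 2m +
    1 > n keeps the logarithm above l + 2, while 2m \<le> n + 1 bounds the loss from the summands
    2.\<close>
  define m where "m = (n + 1) div 2"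
  let ?b = "\<lambda>k. real (card (blocked_at n l \<phi> (2 * k + 1)))"
  have npos: "real n > 0" using n exp_gt_zero[of "real l + 2"] by linarith
  have lower: "(2 * real n + 1) * (1 / (2 * real k + 1)) \<le> ?b k + 2" for k
  proof -
    have "real (2 * n + 1) \<le> real ((2 * k + 1) * (card (blocked_at n l \<phi> (2 * k + 1)) + 2))"
      using card_blocked_at_ge[OF nr col, of "2 * k + 1"] by (intro of_nat_mono) simp
    then show ?thesis by (simp add: divide_le_eq algebra_simps)
  qed
  have "real l + 2 = ln (exp (real l + 2))" by simp
  also have "\<dots> \<le> ln (2 * real m + 1)"
    using n npos by (subst ln_le_cancel_iff) (auto simp: m_def)
  finally have "(real l + 2) / 2 \<le> (\<Sum>k<m. 1 / (2 * real k + 1))"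
    using sum_inverse_odd_ge_ln[of m] by simp
  then have "(2 * real n + 1) * ((real l + 2) / 2) \<le>
      (2 * real n + 1) * (\<Sum>k<m. 1 / (2 * real k + 1))"
    by (intro mult_left_mono) auto
  also have "\<dots> = (\<Sum>k<m. (2 * real n + 1) * (1 / (2 * real k + 1)))"
    by (rule sum_distrib_left)
  also have "\<dots> \<le> (\<Sum>k<m. ?b k + 2)" by (rule sum_mono) (rule lower)
  also have "\<dots> = real (\<Sum>k<m. card (blocked_at n l \<phi> (2 * k + 1))) + 2 * real m"
    by (simp add: sum.distrib)
  also have "\<dots> \<le> real (n * (l - 1)) + (real n + 1)"
  proof (rule add_mono)
    show "real (\<Sum>k<m. card (blocked_at n l \<phi> (2 * k + 1))) \<le> real (n * (l - 1))"
      using sum_card_blocked_at_le card_blocked_le[OF inj missing] by (intro of_nat_mono) (rule order_trans)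
    have "2 * m \<le> n + 1" by (simp add: m_def)
    then show "2 * real m \<le> real n + 1" by linarith
  qed
  also have "\<dots> \<le> real n * real l + (real n + 1)" by (simp add: mult_left_mono)
  \<comment> \<open>The left side of the chain is nl + 2n + l/2 + 1, so n + l/2 \<le> 0 would
    follow.\<close>
  finally show False using npos by (simp add: algebra_simps)
qed

text \<open>Lists of exactly \<open>l\<close> colours defeat every k \<le> l at once, so no
  monotonicity of choosability in \<open>k\<close> has to be proved.\<close>

lemma not_nonrepetitively_choosable:
  fixes l n k :: nat
  assumes n: "real n > exp (real l + 2)" and k: "k \<le> l"
  shows "\<not> nonrepetitively_choosable (with_proj (G_graph n l)) k"
proof
  assume ch: "nonrepetitively_choosable (with_proj (G_graph n l)) k"
  let ?S = "{B. B \<subseteq> {..<l * n} \<and> card B = l}"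
  have "card ?S = (l * n) choose l" by (simp add: n_subsets)
  moreover have "finite ?S" by simp
  ultimately obtain h where h: "bij_betw h {1..(l * n) choose l} ?S"
    using ex_bij_betw_nat_finite_1[of ?S] by auto
  \<comment> \<open>For odd p < 2n, \<open>p div 2\<close> runs through 0, ..., n - 1, so the lists
    of the single vertices are consecutive blocks of length \<open>l\<close> that tile
    \<open>{..<l * n}\<close>.\<close>
  define L where "L v = (case v of Single p \<Rightarrow> {p div 2 * l..<p div 2 * l + l} | Multi q j \<Rightarrow> h j)" for v
  have verts: "verts (with_proj (G_graph n l)) = G_verts n l" by (simp add: G_graph_def)
  have "finite (L v) \<and> card (L v) \<ge> k" if v: "v \<in> G_verts n l" for v
  proof (cases v)
    case (Single p)
    then show ?thesis using k by (simp add: L_def)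
  next
    case (Multi q j)
    then have "j \<in> {1..(l * n) choose l}" using v by (auto simp: G_verts_def)
    then have "h j \<in> ?S" using h by (auto simp: bij_betw_def)
    then show ?thesis using Multi k by (auto simp: L_def intro: finite_subset)
  qed
  then obtain \<phi> where nr: "nonrepetitive (with_proj (G_graph n l)) \<phi>"
    and \<phi>: "\<And>v. v \<in> G_verts n l \<Longrightarrow> \<phi> v \<in> L v"
    using ch[unfolded nonrepetitively_choosable_def verts, rule_format, of L] by blast
  have single: "p div 2 * l \<le> \<phi> (Single p) \<and> \<phi> (Single p) < p div 2 * l + l"
    if "odd p" "p \<le> 2 * n" for p
    using \<phi>[OF Single_mem_G_verts[OF that]] by (simp add: L_def)
  have "\<phi> (Single p) < l * n" if p: "odd p" "p \<le> 2 * n" for p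
  proof -
    have "Suc (p div 2) \<le> n" using p by presburger
    then have "Suc (p div 2) * l \<le> n * l" by (rule mult_le_mono1)
    then show ?thesis using single[OF p] by (simp add: algebra_simps)
  qed
  moreover have "inj_on (\<lambda>p. \<phi> (Single p)) {p \<in> {1..2 * n}. odd p}"
  \<comment> \<open>Division by \<open>l\<close> recovers the number of the block from the colour,
    and hence the odd index.\<close>
  proof (rule inj_on_inverseI[where g = "\<lambda>c. 2 * (c div l) + 1"])
    fix p assume p: "p \<in> {p \<in> {1..2 * n}. odd p}"
    then have "\<phi> (Single p) div l = p div 2"
      using single[of p] by (intro div_nat_eqI) (auto simp: algebra_simps)
    then show "2 * (\<phi> (Single p) div l) + 1 = p" using p by simp
  qed
  moreover have "card (missing n l \<phi> q) < l" if q: "even q" "q \<in> {1..2 * n}" for q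
  \<comment> \<open>Any \<open>l\<close> missing colours would form the list of some copy at
    \<open>q\<close>, and the colour of that copy would be both missing and used.\<close>
  proof (rule ccontr)
    assume "\<not> ?thesis"
    then obtain B where B: "B \<subseteq> missing n l \<phi> q" "card B = l"
      using obtain_subset_with_card_n[of l "missing n l \<phi> q"] by auto
    then have "B \<in> h ` {1..(l * n) choose l}"
      using bij_betw_imp_surj_on[OF h] by (auto simp: missing_def)
    then obtain j where j: "j \<in> {1..(l * n) choose l}" "h j = B" by blast
    then have "\<phi> (Multi q j) \<in> B"
      using \<phi>[OF Multi_mem_G_verts[of q n j l]] q by (simp add: L_def)
    then show False using B(1) j(1) by (auto simp: missing_def)
  qed
  ultimately show False using not_nonrepetitive[OF n] nr by blast
qed

theorem theorem3:
  fixes l n :: nat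
  assumes "l \<ge> 1" and "real n > exp (real l + 2)"
  shows "thue_choice_number (with_proj (G_graph n l)) > l"
proof -
  let ?G = "with_proj (G_graph n l)"
  have "nonrepetitively_choosable ?G (card (verts ?G))"
    by (rule nonrepetitively_choosable_card_verts) (simp add: G_graph_def finite_G_verts)
  \<comment> \<open>Some \<open>k\<close> being choosable, the \<open>LEAST\<close> is attained and
    must itself exceed \<open>l\<close>.\<close>
  then have "nonrepetitively_choosable ?G (thue_choice_number ?G)"
    unfolding thue_choice_number_def by (rule LeastI)
  then show ?thesis using not_nonrepetitively_choosable[OF assms(2)] by (meson not_le)
qed

end
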